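(* Let $X$ be a Banach space and let $K\subset X$ be nonempty, closed, bounded, and convex, with $\operatorname{diam}(K)\le1$. Suppose that $T\colon K\to K$ satisfies $$M:=\sup_{n\ge1}\operatorname{Lip}(T^n)<\infty$$ and is asymptotically nonexpansive away from the diagonal. Then there exist sequences $(\alpha_n)\subset(0,1)$ and $(\kappa_n)\subset(1,\infty)$ such that $\alpha_n\to1$, $\kappa_n\to1$, and $$\|T^nx-T^ny\|\le\kappa_n\|x-y\|^{\alpha_n}$$ for all $x,y\in K$ and $n\ge1$. Consequently, if $T$ is fixed point free, then $K$ fails the fixed point property for asymptotically Hölder nonexpansive mappings.
   Context: For $S\colon K\to K$, $\operatorname{Lip}(S)=\sup_{x,y\in K,\ x\ne y}\frac{\|Sx-Sy\|}{\|x-y\|}$; $T^n$ denotes the $n$-th iterate of $T$. A mapping $T\colon K\to K$ is asymptotically nonexpansive away from the diagonal if there exist sequences $(\delta_n)$ and $(\eta_n)$ of positive reals with $\delta_n\to0$ and $\eta_n\to0$ such that $\|T^nx-T^ny\|\le(1+\eta_n)\|x-y\|$ whenever $n\ge1$ and $x,y\in K$ satisfy $\|x-y\|\ge\delta_n$. A mapping $T\colon K\to K$ is asymptotically Hölder nonexpansive if there exist sequences $(\alpha_n)\subset(0,1]$ and $(\varepsilon_n)\subset[0,\infty)$ such that $\alpha_n\to1$, $\varepsilon_n\to0$, and $\|T^n x-T^n y\|\le(1+\varepsilon_n)\|x-y\|^{\alpha_n}$ for all $x,y\in K$ and $n\ge1$. The set $K$ has the fixed point property for a class of mappings if every self-mapping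 of $K$ in that class has a fixed point; it fails the property otherwise. *)

theory Defs
  imports "HOL-Analysis.Analysis"
begin

text \<open>
  A self-mapping of \<open>K\<close> is a total function \<open>T\<close> with \<open>T \<in> K \<rightarrow> K\<close>; its values outside \<open>K\<close> play no
  role, because every notion below evaluates the iterates of \<open>T\<close> only at points of \<open>K\<close>.
  Sequences are indexed by \<open>n \<ge> 1\<close>; their value at \<open>0\<close> is unconstrained.
\<close>

text \<open>The supremum is taken in \<open>[0, \<infinity>]\<close>, so it is \<open>0\<close> when \<open>K\<close> has at most one point.\<close>

definition Lip :: "'a::real_normed_vector set \<Rightarrow> ('a \<Rightarrow> 'a) \<Rightarrow> ennreal" where
  "Lip K S = (SUP (x, y) \<in> {(x, y). x \<in> K \<and> y \<in> K \<and> x \<noteq> y}.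
     ennreal (norm (S x - S y) / norm (x - y)))"

definition asymp_nonexpansive_away_from_diagonal ::
    "'a::real_normed_vector set \<Rightarrow> ('a \<Rightarrow> 'a) \<Rightarrow> bool" where
  "asymp_nonexpansive_away_from_diagonal K T \<longleftrightarrow>
     (\<exists>\<delta> \<eta> :: nat \<Rightarrow> real.
        (\<forall>n\<ge>1. \<delta> n > 0) \<and> (\<forall>n\<ge>1. \<eta> n > 0) \<and> \<delta> \<longlonglongrightarrow> 0 \<and> \<eta> \<longlonglongrightarrow> 0 \<and>
        (\<forall>n\<ge>1. \<forall>x\<in>K. \<forall>y\<in>K. norm (x - y) \<ge> \<delta> n \<longrightarrow>
           norm ((T ^^ n) x - (T ^^ n) y) \<le> (1 + \<eta> n) * norm (x - y)))"

text \<open>For \<open>x = y\<close> the power below is \<open>0 powr \<alpha> n = 0\<close>, as intended.\<close>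

definition asymp_Hoelder_nonexpansive ::
    "'a::real_normed_vector set \<Rightarrow> ('a \<Rightarrow> 'a) \<Rightarrow> bool" where
  "asymp_Hoelder_nonexpansive K T \<longleftrightarrow>
     (\<exists>\<alpha> \<epsilon> :: nat \<Rightarrow> real.
        (\<forall>n\<ge>1. \<alpha> n \<in> {0<..1}) \<and> (\<forall>n\<ge>1. \<epsilon> n \<in> {0..}) \<and> \<alpha> \<longlonglongrightarrow> 1 \<and> \<epsilon> \<longlonglongrightarrow> 0 \<and>
        (\<forall>n\<ge>1. \<forall>x\<in>K. \<forall>y\<in>K.
           norm ((T ^^ n) x - (T ^^ n) y) \<le> (1 + \<epsilon> n) * norm (x - y) powr \<alpha> n))"

definition fixed_point_property :: "'a set \<Rightarrow> (('a \<Rightarrow> 'a) \<Rightarrow> bool) \<Rightarrow> bool" where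
  "fixed_point_property K C \<longleftrightarrow> (\<forall>T. T \<in> K \<rightarrow> K \<and> C T \<longrightarrow> (\<exists>x\<in>K. T x = x))"

end

theory Submission
  imports Defs "HOL-Real_Asymp.Real_Asymp"
begin

text \<open>
  Let \<open>M > 1\<close> bound all the Lipschitz constants of the iterates, and let \<open>d = norm (x - y) \<le> 1\<close>. If
  \<open>d \<ge> \<delta>\<^sub>n\<close>, the factor \<open>1 + \<eta>\<^sub>n\<close> in front of \<open>d\<close> serves equally well in front of \<open>d powr \<alpha>\<close>, for any
  \<open>\<alpha> \<le> 1\<close>. If \<open>d < \<delta>\<^sub>n\<close>, then with \<open>\<beta> = 1 - \<alpha>\<close>
  \<open>M * d = M * d powr \<beta> * d powr \<alpha> \<le> (M * \<delta>\<^sub>n powr \<beta>) * d powr \<alpha>\<close>, so the loss of the constant \<open>M\<close> is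
  absorbed by lowering the exponent (\<open>Hoelder_bound_of_two_scales\<close>). It remains to let \<open>\<beta>\<close> depend on \<open>\<delta>\<^sub>n\<close> in such a way that \<open>\<beta>\<close>
  tends to \<open>0\<close> while \<open>M * \<delta>\<^sub>n powr \<beta>\<close> tends to \<open>1\<close> as \<open>\<delta>\<^sub>n\<close> tends to \<open>0\<close>; the choice
  \<open>exponent_loss\<close> does this (\<open>tendsto_exponent_loss\<close>, \<open>tendsto_powr_exponent_loss\<close>). A fixed point free \<open>T\<close> is then itself the witness that the
  fixed point property fails.
\<close>

lemma Lip_le_imp_norm_le:
  assumes "Lip K S \<le> ennreal M" and "0 \<le> M" and "x \<in> K" and "y \<in> K"
  shows "norm (S x - S y) \<le> M * norm (x - y)"
proof (cases "x = y")
  case False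
  have "ennreal (norm (S x - S y) / norm (x - y)) \<le> Lip K S"
    unfolding Lip_def using assms(3,4) False by (intro SUP_upper2[of "(x, y)"]) auto
  also have "\<dots> \<le> ennreal M" by (fact assms(1))
  finally have "norm (S x - S y) / norm (x - y) \<le> M"
    using \<open>0 \<le> M\<close> by simp
  then show ?thesis using False by (simp add: field_simps)
qed simp

text \<open>
  The amount \<open>\<beta>\<close> by which the exponent is lowered at the scale \<open>d\<close>. Solving \<open>M * d powr \<beta> = 1\<close> gives
  \<open>ln M / \<bar>ln d\<bar>\<close> for \<open>d < 1\<close>; the larger denominator does not change the asymptotics and keeps
  the value strictly between \<open>0\<close> and \<open>1\<close> for every \<open>d > 0\<close>.
\<close>

definition exponent_loss :: "real \<Rightarrow> real \<Rightarrow> real" where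
  "exponent_loss M d = ln M / (1 + ln M + \<bar>ln d\<bar>)"

lemma exponent_loss_bounds:
  assumes "1 < M"
  shows "0 < exponent_loss M d" and "exponent_loss M d < 1"
proof -
  have "0 < ln M" using assms by simp
  moreover from this have "0 < 1 + ln M + \<bar>ln d\<bar>" by linarith
  ultimately show "0 < exponent_loss M d" and "exponent_loss M d < 1"
    unfolding exponent_loss_def by (auto simp: field_simps)
qed

lemma tendsto_exponent_loss:
  assumes "1 < M"
  shows "(exponent_loss M \<longlongrightarrow> 0) (at_right 0)"
proof -
  have "0 < ln M" using assms by simp
  then show ?thesis unfolding exponent_loss_def by real_asymp
qed

lemma tendsto_powr_exponent_loss:
  assumes "1 < M"
  shows "((\<lambda>d. M * d powr exponent_loss M d) \<longlongrightarrow> 1) (at_right 0)"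
proof -
  define m where "m = ln M"
  have m: "0 < m" and M: "M = exp m" using assms by (simp_all add: m_def)
  have "((\<lambda>d. exp (m * (1 + m) / (1 + m - ln d))) \<longlongrightarrow> 1) (at_right 0)"
    using m by real_asymp
  moreover have "\<forall>\<^sub>F d in at_right 0.
      exp (m * (1 + m) / (1 + m - ln d)) = M * d powr exponent_loss M d"
  proof (rule eventually_mono)
    show "\<forall>\<^sub>F d::real in at_right 0. d \<in> {0<..<1}"
      by (rule eventually_at_right_real) simp
  next
    fix d :: real assume d: "d \<in> {0<..<1}"
    then have "ln d < 0" by simp
    then have "m * (1 + m) / (1 + m - ln d) = m + m / (1 + m + \<bar>ln d\<bar>) * ln d"
      using m by (simp add: field_simps)
    then show "exp (m * (1 + m) / (1 + m - ln d)) = M * d powr exponent_loss M d"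
      using d by (simp add: M exponent_loss_def powr_def exp_add)
  qed
  ultimately show ?thesis by (rule Lim_transform_eventually)
qed

text \<open>
  Here \<open>d\<close> stands for the distance of two points and \<open>D\<close> for the distance of their images under one
  map, which is \<open>M\<close>-Lipschitz, and even \<open>c\<close>-Lipschitz at distances of at least \<open>\<delta>\<close>.
\<close>

lemma Hoelder_bound_of_two_scales:
  fixes d D :: real
  assumes "0 \<le> d" and "d \<le> 1" and "0 \<le> \<beta>" and "0 \<le> M" and "0 \<le> c"
    and small: "D \<le> M * d" and large: "\<delta> \<le> d \<Longrightarrow> D \<le> c * d"
  shows "D \<le> max c (M * \<delta> powr \<beta>) * d powr (1 - \<beta>)"
proof (cases "d = 0")
  case True
  then show ?thesis using small by simp
next
  case False
  then have "0 < d" using \<open>0 \<le> d\<close> by simp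
  then have split: "d = d powr \<beta> * d powr (1 - \<beta>)"
    by (simp flip: powr_add)
  show ?thesis
  proof (cases "\<delta> \<le> d")
    case True
    have "d powr \<beta> \<le> 1" using assms(1-3) by (simp add: powr_le1)
    then have "d \<le> d powr (1 - \<beta>)"
      using split mult_right_mono[of "d powr \<beta>" 1 "d powr (1 - \<beta>)"] by simp
    then have "D \<le> c * d powr (1 - \<beta>)"
      using large[OF True] \<open>0 \<le> c\<close> mult_left_mono order_trans by blast
    also have "\<dots> \<le> max c (M * \<delta> powr \<beta>) * d powr (1 - \<beta>)"
      by (intro mult_right_mono) auto
    finally show ?thesis .
  next
    case False
    have "D \<le> M * d powr \<beta> * d powr (1 - \<beta>)"
      using small split by (simp add: mult.assoc)
    also have "\<dots> \<le> M * \<delta> powr \<beta> * d powr (1 - \<beta>)"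
      using False \<open>0 < d\<close> assms(3,4) by (intro mult_right_mono mult_left_mono powr_mono2) auto
    also have "\<dots> \<le> max c (M * \<delta> powr \<beta>) * d powr (1 - \<beta>)"
      by (intro mult_right_mono) auto
    finally show ?thesis .
  qed
qed

lemma Hoelder_sequence_of_away_from_diagonal:
  fixes K :: "'a::real_normed_vector set"
  assumes "bounded K" and "diameter K \<le> 1"
    and Lip: "(SUP n\<in>{1..}. Lip K (T ^^ n)) < \<infinity>"
    and "asymp_nonexpansive_away_from_diagonal K T"
  obtains \<alpha> \<kappa> :: "nat \<Rightarrow> real"
    where "\<And>n. n \<ge> 1 \<Longrightarrow> \<alpha> n \<in> {0<..<1}" and "\<And>n. n \<ge> 1 \<Longrightarrow> \<kappa> n \<in> {1<..}"
      and "\<alpha> \<longlonglongrightarrow> 1" and "\<kappa> \<longlonglongrightarrow> 1"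
      and "\<And>n x y. n \<ge> 1 \<Longrightarrow> x \<in> K \<Longrightarrow> y \<in> K \<Longrightarrow>
             norm ((T ^^ n) x - (T ^^ n) y) \<le> \<kappa> n * norm (x - y) powr \<alpha> n"
proof -
  obtain \<delta> \<eta> :: "nat \<Rightarrow> real"
    where \<delta>: "\<And>n. n \<ge> 1 \<Longrightarrow> \<delta> n > 0" "\<delta> \<longlonglongrightarrow> 0"
      and \<eta>: "\<And>n. n \<ge> 1 \<Longrightarrow> \<eta> n > 0" "\<eta> \<longlonglongrightarrow> 0"
      and away: "\<And>n x y. n \<ge> 1 \<Longrightarrow> x \<in> K \<Longrightarrow> y \<in> K \<Longrightarrow> \<delta> n \<le> norm (x - y) \<Longrightarrow>
             norm ((T ^^ n) x - (T ^^ n) y) \<le> (1 + \<eta> n) * norm (x - y)"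
    using assms(4) unfolding asymp_nonexpansive_away_from_diagonal_def by blast
  obtain r where r: "0 \<le> r" "(SUP n\<in>{1..}. Lip K (T ^^ n)) = ennreal r"
    using Lip unfolding infinity_ennreal_def less_top_ennreal by blast
  define M where "M = max 2 r"
  have M: "1 < M" by (simp add: M_def)
  have Lip_bound: "norm ((T ^^ n) x - (T ^^ n) y) \<le> M * norm (x - y)"
    if "n \<ge> 1" "x \<in> K" "y \<in> K" for n x y
  proof (rule Lip_le_imp_norm_le[OF _ _ that(2,3)])
    have "Lip K (T ^^ n) \<le> ennreal r"
      unfolding r(2)[symmetric] using that(1) by (intro SUP_upper) simp
    also have "\<dots> \<le> ennreal M" by (intro ennreal_leI) (simp add: M_def)
    finally show "Lip K (T ^^ n) \<le> ennreal M" .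
  qed (use M in simp)
  have \<delta>_right: "filterlim \<delta> (at_right 0) sequentially"
    using \<delta> eventually_mono[OF eventually_ge_at_top[of 1], of "\<lambda>n. \<delta> n > 0"]
    by (intro tendsto_imp_filterlim_at_right) auto
  define \<beta> where "\<beta> n = exponent_loss M (\<delta> n)" for n
  define \<kappa> where "\<kappa> n = max (1 + \<eta> n) (M * \<delta> n powr \<beta> n)" for n
  show thesis
  proof (rule that[of "\<lambda>n. 1 - \<beta> n" \<kappa>])
    show "1 - \<beta> n \<in> {0<..<1}" for n
      using exponent_loss_bounds[OF M] by (simp add: \<beta>_def)
    show "\<kappa> n \<in> {1<..}" if "n \<ge> 1" for n
      using \<eta>(1)[OF that] by (simp add: \<kappa>_def less_max_iff_disj)
    have "\<beta> \<longlonglongrightarrow> 0"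
      unfolding \<beta>_def by (rule filterlim_compose[OF tendsto_exponent_loss[OF M] \<delta>_right])
    from tendsto_diff[OF tendsto_const[of 1] this] show "(\<lambda>n. 1 - \<beta> n) \<longlonglongrightarrow> 1"
      by simp
    have "(\<lambda>n. M * \<delta> n powr \<beta> n) \<longlonglongrightarrow> 1"
      unfolding \<beta>_def by (rule filterlim_compose[OF tendsto_powr_exponent_loss[OF M] \<delta>_right])
    with tendsto_add[OF tendsto_const[of 1] \<eta>(2)] have "\<kappa> \<longlonglongrightarrow> max (1 + 0) 1"
      unfolding \<kappa>_def by (rule tendsto_max)
    then show "\<kappa> \<longlonglongrightarrow> 1" by simp
    fix n x y assume n: "n \<ge> (1::nat)" and xy: "x \<in> K" "y \<in> K"
    have "norm (x - y) \<le> 1"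
      using diameter_bounded_bound[OF assms(1) xy] assms(2) by (simp add: dist_norm)
    then show "norm ((T ^^ n) x - (T ^^ n) y) \<le> \<kappa> n * norm (x - y) powr (1 - \<beta> n)"
      unfolding \<kappa>_def
      using exponent_loss_bounds(1)[OF M, of "\<delta> n"] M \<eta>(1)[OF n] Lip_bound[OF n xy] away[OF n xy]
      by (intro Hoelder_bound_of_two_scales) (auto simp: \<beta>_def)
  qed
qed

theorem theorem3p9:
  fixes K :: "'a::banach set" and T :: "'a \<Rightarrow> 'a"
  assumes "K \<noteq> {}" and "closed K" and "bounded K" and "convex K" and "diameter K \<le> 1"
    and "T \<in> K \<rightarrow> K"
    and "(SUP n\<in>{1..}. Lip K (T ^^ n)) < \<infinity>"
    and "asymp_nonexpansive_away_from_diagonal K T"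
  shows "(\<exists>\<alpha> \<kappa> :: nat \<Rightarrow> real.
            (\<forall>n\<ge>1. \<alpha> n \<in> {0<..<1}) \<and> (\<forall>n\<ge>1. \<kappa> n \<in> {1<..}) \<and> \<alpha> \<longlonglongrightarrow> 1 \<and> \<kappa> \<longlonglongrightarrow> 1 \<and>
            (\<forall>n\<ge>1. \<forall>x\<in>K. \<forall>y\<in>K.
               norm ((T ^^ n) x - (T ^^ n) y) \<le> \<kappa> n * norm (x - y) powr \<alpha> n))
       \<and> ((\<forall>x\<in>K. T x \<noteq> x) \<longrightarrow> \<not> fixed_point_property K (asymp_Hoelder_nonexpansive K))"
proof -
  obtain \<alpha> \<kappa> :: "nat \<Rightarrow> real"
    where \<alpha>: "\<And>n. n \<ge> 1 \<Longrightarrow> \<alpha> n \<in> {0<..<1}" "\<alpha> \<longlonglongrightarrow> 1"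
      and \<kappa>: "\<And>n. n \<ge> 1 \<Longrightarrow> \<kappa> n \<in> {1<..}" "\<kappa> \<longlonglongrightarrow> 1"
      and bound: "\<And>n x y. n \<ge> 1 \<Longrightarrow> x \<in> K \<Longrightarrow> y \<in> K \<Longrightarrow>
             norm ((T ^^ n) x - (T ^^ n) y) \<le> \<kappa> n * norm (x - y) powr \<alpha> n"
    using Hoelder_sequence_of_away_from_diagonal[OF assms(3,5,7,8)] by metis
  have "asymp_Hoelder_nonexpansive K T"
    unfolding asymp_Hoelder_nonexpansive_def
  proof (rule exI[of _ \<alpha>], rule exI[of _ "\<lambda>n. \<kappa> n - 1"], intro conjI allI ballI impI)
    show "\<alpha> n \<in> {0<..1}" if "n \<ge> 1" for n using \<alpha>(1)[OF that] by simp
    show "\<kappa> n - 1 \<in> {0..}" if "n \<ge> 1" for n using \<kappa>(1)[OF that] by simp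
    show "(\<lambda>n. \<kappa> n - 1) \<longlonglongrightarrow> 0"
      using tendsto_diff[OF \<kappa>(2) tendsto_const[of 1]] by simp
  qed (use \<alpha>(2) bound in auto)
  then have "\<not> fixed_point_property K (asymp_Hoelder_nonexpansive K)" if "\<forall>x\<in>K. T x \<noteq> x"
    using that assms(6) unfolding fixed_point_property_def by blast
  moreover have "\<exists>\<alpha> \<kappa> :: nat \<Rightarrow> real.
            (\<forall>n\<ge>1. \<alpha> n \<in> {0<..<1}) \<and> (\<forall>n\<ge>1. \<kappa> n \<in> {1<..}) \<and> \<alpha> \<longlonglongrightarrow> 1 \<and> \<kappa> \<longlonglongrightarrow> 1 \<and>
            (\<forall>n\<ge>1. \<forall>x\<in>K. \<forall>y\<in>K.
               norm ((T ^^ n) x - (T ^^ n) y) \<le> \<kappa> n * norm (x - y) powr \<alpha> n)"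
    using \<alpha> \<kappa> bound by blast
  ultimately show ?thesis by blast
qed

end
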